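(* Let $r(x)=\sum_{n\ge 0}x^{2^n-1}$ and $h_n=H_n(1-xr(x))$ for $n\ge 0$. Then the sequence $(h_n)_{n\ge 0}$ is $2$-regular.
   Context: For a power series $f(x)=\sum_{i\ge 0}a_ix^i$ and $n\ge 1$, $H_n(f)=\det(a_{i+j})_{0\le i,j\le n-1}$, $H_0(f)=1$. An integer sequence $(x_n)_{n\ge0}$ is $2$-regular if the $\mathbb{Z}$-module generated by its $2$-kernel $\{(x_{2^in+j})_{n\ge 0} : i\ge 0,\ 0\le j\le 2^i-1\}$ is finitely generated. *)

theory Defs
  imports
    "HOL-Library.Function_Algebras"
    "HOL-Computational_Algebra.Formal_Power_Series"
    "Jordan_Normal_Form.Determinant"
begin

definition hankel_det :: "nat \<Rightarrow> 'a::comm_ring_1 fps \<Rightarrow> 'a" where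
  "hankel_det n f = det (mat n n (\<lambda>(i, j). fps_nth f (i + j)))"

lemma hankel_det_0 [simp]: "hankel_det 0 f = 1"
  by (simp add: hankel_det_def)

text \<open>The infinite sum is taken in the usual metric topology on formal power series;
  \<open>r_series_sums\<close> shows that it converges.\<close>

definition r_series :: "int fps" where
  "r_series = (\<Sum>n. fps_X ^ (2 ^ n - 1))"

lemma r_series_sums_aux:
  "(\<lambda>n. fps_X ^ (2 ^ n - 1) :: int fps) sums Abs_fps (\<lambda>k. if \<exists>n. k = 2 ^ n - 1 then 1 else 0)"
proof -
  have inj: "inj (\<lambda>n::nat. 2 ^ n - 1 :: nat)"
  proof (rule injI)
    fix a b :: nat
    assume *: "2 ^ a - 1 = (2 ^ b - 1 :: nat)"
    have "(2::nat) ^ a > 0" "(2::nat) ^ b > 0" by simp_all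
    with * have "(2::nat) ^ a = 2 ^ b" by linarith
    then show "a = b" by simp
  qed
  have coeff: "fps_nth (\<Sum>n<N. fps_X ^ (2 ^ n - 1) :: int fps) k
      = (if \<exists>n. k = 2 ^ n - 1 then 1 else 0)" if "k < N" for N k :: nat
  proof -
    have nth: "fps_nth (\<Sum>n<N. fps_X ^ (2 ^ n - 1) :: int fps) k
        = (\<Sum>n<N. if k = 2 ^ n - 1 then 1 else 0)"
      by (simp add: fps_sum_nth)
    show ?thesis
    proof (cases "\<exists>n. k = 2 ^ n - 1")
      case True
      then obtain m where m: "k = 2 ^ m - 1" by blast
      have "m < 2 ^ m" by (rule less_exp)
      with m that have "m < N" by linarith
      have "k = 2 ^ n - 1 \<longleftrightarrow> n = m" for n
        using inj m by (auto dest: injD)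
      then show ?thesis using nth \<open>m < N\<close> by simp
    next
      case False
      then show ?thesis using nth by simp
    qed
  qed
  show ?thesis
    unfolding sums_def tendsto_fps_iff
  proof
    fix k :: nat
    show "\<forall>\<^sub>F N in sequentially. fps_nth (\<Sum>n<N. fps_X ^ (2 ^ n - 1) :: int fps) k
        = fps_nth (Abs_fps (\<lambda>k. if \<exists>n. k = 2 ^ n - 1 then 1 else 0)) k"
      using eventually_gt_at_top[of k] by eventually_elim (simp only: coeff fps_nth_Abs_fps)
  qed
qed

lemma r_series_sums: "(\<lambda>n. fps_X ^ (2 ^ n - 1)) sums r_series"
  using r_series_sums_aux unfolding r_series_def by (simp only: sums_iff)

lemma fps_nth_r_series: "fps_nth r_series k = (if \<exists>n. k = 2 ^ n - 1 then 1 else 0)"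
  using r_series_sums_aux by (simp add: r_series_def sums_iff)

text \<open>Integer sequences form a \<open>\<int>\<close>-module under pointwise addition and scaling.\<close>

global_interpretation int_seq: Modules.module "\<lambda>(c::int) (x::nat \<Rightarrow> int) n. c * x n"
  by unfold_locales (auto simp: fun_eq_iff algebra_simps)

definition two_kernel :: "(nat \<Rightarrow> 'a) \<Rightarrow> (nat \<Rightarrow> 'a) set" where
  "two_kernel x = {(\<lambda>n. x (2 ^ i * n + j)) | i j. j \<le> 2 ^ i - 1}"

definition two_regular :: "(nat \<Rightarrow> int) \<Rightarrow> bool" where
  "two_regular x \<longleftrightarrow>
     (\<exists>B. finite B \<and> int_seq.span B = int_seq.span (two_kernel x))"

end

(*
  The entries of the Hankel matrix are supported on i + j = 0 and i + j = 2 ^ k, so it is the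
  weighted adjacency matrix of a graph: a tree rooted at 0, with loops at 0 and at the powers of 2.
  If 2 ^ k < n <= 2 ^ (k + 1), every vertex above 2 ^ k is a leaf; removing these leaves together
  with their parents, and then the vertex 2 ^ k, leaves the vertices below 2 ^ (k + 1) + 1 - n and
  raises the weight of the loop at 0 by one. On m = n - 1 this is binary complementation, so that
  h (m + 1) is, up to an explicit sign, one more than the number of runs in the binary expansion
  of m. Linear relations between the subsequences of h then close up at level 8.
*)
theory Submission
  imports Defs
begin

section \<open>Determinants indexed by finite sets\<close>

text \<open>Indexing by an arbitrary finite set lets vertices be deleted one at a time without
  renumbering the others.\<close>

definition set_det :: "'b set \<Rightarrow> ('b \<Rightarrow> 'b \<Rightarrow> 'a::comm_ring_1) \<Rightarrow> 'a" where
  "set_det S A = (\<Sum>p | p permutes S. of_int (sign p) * (\<Prod>i\<in>S. A i (p i)))"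

lemma set_det_empty [simp]: "set_det {} A = 1"
  by (simp add: set_det_def)

lemma det_mat_eq_set_det: "det (mat n n (\<lambda>(i, j). A i j)) = set_det {0..<n} A"
proof -
  have "(\<Prod>i = 0..<n. mat n n (\<lambda>(i, j). A i j) $$ (i, p i)) = (\<Prod>i = 0..<n. A i (p i))"
    if "p permutes {0..<n}" for p
    using that by (intro prod.cong refl) (auto simp: permutes_in_image[OF that, of _, simplified])
  then show ?thesis
    by (auto simp: det_def set_det_def intro!: sum.cong)
qed

lemma sign_transpose_comp:
  assumes "finite S" "q permutes S"
  shows "sign (transpose a b \<circ> q) = (if a = b then sign q else - sign q)"
proof -
  have "permutation q"
    using assms by (auto simp: permutation_permutes)
  then show ?thesis
    by (auto simp: sign_compose permutation_swap_id sign_swap_id)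
qed

text \<open>A permutation of \<open>insert v S\<close> is uniquely
  \<open>transpose v b \<circ> q\<close> with \<open>q\<close> permuting \<open>S\<close>. As
  \<open>q\<close> fixes \<open>v\<close>, the image of \<open>v\<close> is \<open>b\<close>, and
  row \<open>v\<close> contributes \<open>A v b\<close>.\<close>

lemma set_det_insert:
  assumes "finite S" "v \<notin> S"
  shows "set_det (insert v S) A =
    (\<Sum>b\<in>insert v S. A v b *
      (\<Sum>q | q permutes S. of_int (sign (transpose v b \<circ> q)) * (\<Prod>i\<in>S. A i (transpose v b (q i)))))"
proof -
  have fix_v: "q v = v" if "q permutes S" for q
    using that assms(2) by (simp add: permutes_not_in)
  have "of_int (sign (transpose v b \<circ> q)) * (\<Prod>i\<in>insert v S. A i ((transpose v b \<circ> q) i)) =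
      A v b * (of_int (sign (transpose v b \<circ> q)) * (\<Prod>i\<in>S. A i (transpose v b (q i))))"
    if "q permutes S" for b q
    using assms by (simp add: fix_v[OF that] mult_ac)
  then show ?thesis
    unfolding set_det_def sum_over_permutations_insert[OF assms] sum_distrib_left
    by (intro sum.cong refl) auto
qed

lemma set_det_isolated:
  assumes "finite S" "v \<notin> S" "\<And>j. j \<in> S \<Longrightarrow> A v j = 0"
  shows "set_det (insert v S) A = A v v * set_det S A"
  using assms by (simp add: set_det_insert) (simp add: set_det_def)

text \<open>The only possible neighbour of \<open>v\<close> is \<open>u\<close>, so in a
  nonvanishing term \<open>v\<close> is either a fixed point or in a 2-cycle with \<open>u\<close>,
  which has sign -1.\<close>

lemma set_det_pendant:
  assumes fin: "finite S" and "v \<notin> S" "u \<notin> S" "v \<noteq> u"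
    and row: "\<And>j. j \<in> S \<Longrightarrow> A v j = 0" and col: "\<And>j. j \<in> S \<Longrightarrow> A j v = 0"
  shows "set_det (insert v (insert u S)) A =
    A v v * set_det (insert u S) A - A v u * A u v * set_det S A"
proof -
  define F where "F q = of_int (sign (transpose v u \<circ> q)) *
    (\<Prod>i\<in>insert u S. A i (transpose v u (q i)))" for q :: "'a \<Rightarrow> 'a"
  have F_fix: "F q = - (A u v * (of_int (sign q) * (\<Prod>i\<in>S. A i (q i))))" if q: "q permutes S" for q
  proof -
    have "q u = u" using q assms by (simp add: permutes_not_in)
    moreover have "transpose v u (q i) = q i" if "i \<in> S" for i
      using that assms permutes_in_image[OF q, of i] by (auto simp: transpose_def)
    ultimately show ?thesis
      using assms sign_transpose_comp[OF fin q, of v u] by (simp add: F_def)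
  qed
  \<comment> \<open>Here \<open>v\<close> goes to \<open>u\<close> but \<open>u\<close> goes to
    \<open>c\<close> in \<open>S\<close>; the element of \<open>S\<close> that is sent to
    \<open>v\<close> then gives a zero factor.\<close>
  have F_move: "F (transpose u c \<circ> q) = 0" if q: "q permutes S" and c: "c \<in> S" for q c
  proof -
    obtain i where i: "q i = c" "i \<in> S"
      using permutes_image[OF q] c by (metis imageE)
    then have "A i (transpose v u ((transpose u c \<circ> q) i)) = 0"
      by (simp add: col)
    then have "(\<Prod>i\<in>insert u S. A i (transpose v u ((transpose u c \<circ> q) i))) = 0"
      using i(2) fin by (intro prod_zero) blast+
    then show ?thesis by (simp add: F_def)
  qed
  have "(\<Sum>q | q permutes insert u S. F q) = (\<Sum>c\<in>insert u S. \<Sum>q | q permutes S. F (transpose u c \<circ> q))"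
    using assms by (subst sum_over_permutations_insert) auto
  also have "\<dots> = (\<Sum>q | q permutes S. F q)"
    using assms by (simp add: F_move)
  also have "\<dots> = - (A u v * set_det S A)"
    by (simp add: F_fix set_det_def sum_distrib_left sum_negf)
  finally have *: "(\<Sum>q | q permutes insert u S. F q) = - (A u v * set_det S A)" .
  have "set_det (insert v (insert u S)) A =
      A v v * set_det (insert u S) A + A v u * (\<Sum>q | q permutes insert u S. F q)"
    unfolding F_def using assms
    by (subst set_det_insert) (auto simp: set_det_def)
  then show ?thesis by (simp add: * mult.assoc)
qed

section \<open>The Hankel matrix as a weighted tree\<close>

definition pow_hankel :: "nat \<Rightarrow> nat \<Rightarrow> int" where
  "pow_hankel i j = (if i + j = 0 then 1 else if \<exists>n. i + j = 2 ^ n then -1 else 0)"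

lemma pow_hankel_sym: "pow_hankel i j = pow_hankel j i"
  by (simp add: pow_hankel_def add.commute)

lemma hankel_det_eq_set_det:
  "hankel_det n (1 - fps_X * r_series) = set_det {0..<n} pow_hankel"
proof -
  \<comment> \<open>At \<open>k = 0\<close> truncated subtraction would make the left side true
    through \<open>n = 0\<close>.\<close>
  have "(\<exists>n. k - 1 = 2 ^ n - 1) \<longleftrightarrow> (\<exists>n. k = 2 ^ n)" if "k > 0" for k :: nat
  proof -
    have "k - 1 = 2 ^ n - 1 \<longleftrightarrow> k = 2 ^ n" for n :: nat
      using that by (metis One_nat_def Suc_pred zero_less_numeral zero_less_power)
    then show ?thesis by simp
  qed
  then have "fps_nth (1 - fps_X * r_series) (i + j) = pow_hankel i j" for i j
    by (auto simp: pow_hankel_def fps_nth_r_series)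
  then show ?thesis
    by (simp add: hankel_det_def det_mat_eq_set_det)
qed

section \<open>Removing the leaves above a power of 2\<close>

lemma power_two_between:
  fixes n :: nat
  assumes "2 ^ k < (2::nat) ^ n" "(2::nat) ^ n < 2 ^ (k + 2)"
  shows "n = k + 1"
proof -
  have "k < n" "n < k + 2"
    using assms by (auto simp only: power_strict_increasing_iff)
  then show ?thesis by simp
qed

lemma pow_hankel_between:
  assumes "2 ^ k < i + j" "i + j < 2 ^ (k + 2)"
  shows "pow_hankel i j = (if i + j = 2 ^ (k + 1) then -1 else 0)"
proof -
  have "(\<exists>n. i + j = 2 ^ n) \<longleftrightarrow> i + j = 2 ^ (k + 1)"
    using assms power_two_between by metis
  then show ?thesis using assms(1) by (auto simp: pow_hankel_def)
qed

text \<open>The vertices \<open>2 ^ k + d\<close> with \<open>d > 0\<close>, taken in decreasing order, are leaves attached to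
  \<open>2 ^ k - d\<close>.\<close>

lemma set_det_remove_leaves:
  assumes "d < 2 ^ k" "c \<le> 2 ^ k - d"
  shows "set_det ({a..<c} \<union> {2 ^ k - d..2 ^ k + d}) pow_hankel =
    (-1) ^ d * set_det (insert (2 ^ k) {a..<c}) pow_hankel"
  using assms
proof (induction d)
  case 0
  then show ?case by simp
next
  case (Suc d)
  define S where "S = {a..<c} \<union> {2 ^ k - d..2 ^ k + d}"
  define v where "v = 2 ^ k + Suc d"
  define u where "u = 2 ^ k - Suc d"
  have vu: "v + u = 2 ^ (k + 1)" "u < 2 ^ k - d" "2 ^ k - d = Suc u" "2 ^ k < v"
    using Suc.prems by (auto simp: v_def u_def)
  have eq: "{a..<c} \<union> {2 ^ k - Suc d..2 ^ k + Suc d} = insert v (insert u S)"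
    using Suc.prems by (auto simp: S_def v_def u_def)
  have notin: "v \<notin> S" "u \<notin> S" "v \<noteq> u"
    using Suc.prems by (auto simp: S_def v_def u_def)
  \<comment> \<open>Since \<open>v\<close> is the largest vertex and
    \<open>2 ^ k < v < 2 ^ (k + 1)\<close>, the only power of 2 that \<open>v + j\<close> can equal
    is \<open>2 ^ (k + 1)\<close>. In particular \<open>v\<close> has no loop.\<close>
  have row: "pow_hankel v j = (if j = u then -1 else 0)" if "j \<in> insert v S \<or> j = u" for j
  proof -
    have "j \<le> v" using that Suc.prems by (auto simp: S_def v_def u_def)
    then have "v + j < 2 ^ (k + 2)" using Suc.prems by (simp add: v_def)
    with vu(4) have "pow_hankel v j = (if v + j = 2 ^ (k + 1) then -1 else 0)"
      by (intro pow_hankel_between) auto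
    then show ?thesis using vu(1) by auto
  qed
  have vv: "pow_hankel v v = 0" and v_u: "pow_hankel v u = -1" "pow_hankel u v = -1"
    using notin row[of v] row[of u] pow_hankel_sym[of u v] by auto
  have rowS: "pow_hankel v j = 0" "pow_hankel j v = 0" if "j \<in> S" for j
    using that row[of j] notin pow_hankel_sym[of j v] by auto
  have "set_det (insert v (insert u S)) pow_hankel = - set_det S pow_hankel"
    using set_det_pendant[of S v u pow_hankel] notin rowS vv v_u by (simp add: S_def)
  also have "\<dots> = - ((-1) ^ d * set_det (insert (2 ^ k) {a..<c}) pow_hankel)"
    unfolding S_def using Suc by simp
  finally show ?case by (simp only: eq) simp
qed

section \<open>Reflection of the vertex set at a power of 2\<close>

lemma pow_hankel_power_row:
  assumes "0 < j" "j < 2 ^ k"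
  shows "pow_hankel (2 ^ k) j = 0" "pow_hankel j (2 ^ k) = 0"
  using assms pow_hankel_between[of k "2 ^ k" j] pow_hankel_sym[of j "2 ^ k"] by auto

lemma pow_hankel_power_diag: "pow_hankel (2 ^ k) (2 ^ k) = -1"
proof -
  have "2 ^ k + 2 ^ k = (2::nat) ^ (k + 1)" by simp
  then show ?thesis unfolding pow_hankel_def by (metis power_not_zero zero_neq_numeral)
qed

lemma pow_hankel_power_0: "pow_hankel (2 ^ k) 0 = -1" "pow_hankel 0 (2 ^ k) = -1"
  by (auto simp: pow_hankel_def)

lemma interval_reflect:
  fixes d k a :: nat
  assumes "d < 2 ^ k" "a \<le> 1"
  shows "{a..<2 ^ k + d + 1} = {a..<2 ^ k - d} \<union> {2 ^ k - d..2 ^ k + d}"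
  using assms by auto

text \<open>Among smaller vertices only 0 is adjacent to \<open>2 ^ k\<close>. With 0 absent and the
  leaves gone, \<open>2 ^ k\<close> is isolated and contributes its loop weight -1.\<close>

lemma set_det_reflect_1:
  assumes "d < 2 ^ k"
  shows "set_det {1..<2 ^ k + d + 1} pow_hankel =
    - ((-1) ^ d * set_det {1..<2 ^ k - d} pow_hankel)"
proof -
  have "set_det (insert (2 ^ k) {1..<2 ^ k - d}) pow_hankel = - set_det {1..<2 ^ k - d} pow_hankel"
    using set_det_isolated[of "{1..<2 ^ k - d}" "2 ^ k" pow_hankel]
    by (simp add: pow_hankel_power_row pow_hankel_power_diag)
  then show ?thesis
    using assms by (simp only: interval_reflect set_det_remove_leaves)
qed

text \<open>After the leaves are removed, \<open>2 ^ k\<close> is pendant at the root 0, with loop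
  and edge weight -1. By linearity in the entry at (0, 0), the sum of the two determinants is the
  one with the loop at 0 raised by 1.\<close>

lemma set_det_reflect_0:
  assumes "d < 2 ^ k"
  shows "set_det {0..<2 ^ k + d + 1} pow_hankel =
    - ((-1) ^ d * (set_det {0..<2 ^ k - d} pow_hankel + set_det {1..<2 ^ k - d} pow_hankel))"
proof -
  have split: "{0..<2 ^ k - d} = insert 0 {1..<2 ^ k - d}"
    using assms by auto
  have "set_det (insert (2 ^ k) (insert 0 {1..<2 ^ k - d})) pow_hankel =
      - set_det (insert 0 {1..<2 ^ k - d}) pow_hankel - set_det {1..<2 ^ k - d} pow_hankel"
    using set_det_pendant[of "{1..<2 ^ k - d}" "2 ^ k" 0 pow_hankel]
    by (simp add: pow_hankel_power_row pow_hankel_power_diag pow_hankel_power_0)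
  then have "set_det (insert (2 ^ k) {0..<2 ^ k - d}) pow_hankel =
      - (set_det {0..<2 ^ k - d} pow_hankel + set_det {1..<2 ^ k - d} pow_hankel)"
    by (simp only: split)
  then show ?thesis
    using assms by (simp only: interval_reflect set_det_remove_leaves)
qed

section \<open>Closed form\<close>

text \<open>Counts the maximal blocks of equal binary digits. The leading 1 is compared with a 0
  before it, which itself is not counted.\<close>

fun runs :: "nat \<Rightarrow> int" where
  "runs n = (if n = 0 then 0 else runs (n div 2) + (if even n = even (n div 2) then 0 else 1))"

declare runs.simps [simp del]

lemma runs_0 [simp]: "runs 0 = 0"
  by (simp add: runs.simps)

lemma runs_double: "runs (2 * n) = runs n + (if even n then 0 else 1)"
  by (cases "n = 0") (simp_all add: runs.simps[of "2 * n"])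

lemma runs_double_Suc: "runs (Suc (2 * n)) = runs n + (if even n then 1 else 0)"
  by (simp add: runs.simps[of "Suc (2 * n)"])

text \<open>This is \<open>(-1) ^ (runs n div 2)\<close>, in a form which avoids the division.\<close>

fun runs_sign :: "nat \<Rightarrow> int" where
  "runs_sign n = (if n = 0 then 1
     else runs_sign (n div 2) * (if even n \<and> odd (n div 2) then -1 else 1))"

declare runs_sign.simps [simp del]

lemma runs_sign_0 [simp]: "runs_sign 0 = 1"
  by (simp add: runs_sign.simps)

lemma runs_sign_double: "runs_sign (2 * n) = (if even n then runs_sign n else - runs_sign n)"
  by (cases "n = 0") (simp_all add: runs_sign.simps[of "2 * n"])

lemma runs_sign_double_Suc: "runs_sign (Suc (2 * n)) = runs_sign n"
  by (simp add: runs_sign.simps[of "Suc (2 * n)"])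

text \<open>The value of the determinant on the vertices \<open>1..n\<close>, without the root; the
  extra sign records whether the last two binary digits differ.\<close>

definition det_sign :: "nat \<Rightarrow> int" where
  "det_sign n = (if even n = even (n div 2) then runs_sign n else - runs_sign n)"

lemma det_sign_double: "det_sign (2 * n) = runs_sign n"
  by (simp add: det_sign_def runs_sign_double)

lemma det_sign_double_Suc: "det_sign (Suc (2 * n)) = (if even n then - runs_sign n else runs_sign n)"
  by (simp add: det_sign_def runs_sign_double_Suc)

text \<open>The number \<open>2 ^ (k + 1) - 1 - m\<close> is the binary complement of \<open>m\<close>, so it has one run less.\<close>

lemma runs_complement:
  assumes "m + m' + 1 = 2 ^ (k + 1)" "2 ^ k \<le> m"
  shows "runs m = runs m' + 1 \<and> runs_sign m = (if even m' then runs_sign m' else - runs_sign m')"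
  using assms
proof (induction k arbitrary: m m')
  case 0
  then have "m = Suc (2 * 0)" "m' = 0" by auto
  then show ?case using runs_double_Suc[of 0] runs_sign_double_Suc[of 0] by simp
next
  case (Suc k)
  \<comment> \<open>Dropping the last digits, which are opposite, leaves complementary numbers
    again. In the base case, \<open>m = 1\<close> and \<open>m' = 0\<close>, the leading block of
    ones becomes leading zeros, which is the lost run.\<close>
  define a a' where "a = m div 2" and "a' = m' div 2"
  have parity: "even m' \<longleftrightarrow> odd m"
    using Suc.prems(1) by (metis even_Suc even_add even_mult_iff even_numeral power_Suc
      Suc_eq_plus1)
  have sum: "a + a' + 1 = 2 ^ (k + 1)" "2 ^ k \<le> a"
    using Suc.prems parity by (auto simp: a_def a'_def elim!: evenE oddE)
  note IH = Suc.IH[OF sum]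
  have parity': "even a' \<longleftrightarrow> odd a"
    using sum(1) by (metis even_Suc even_add even_mult_iff even_numeral power_Suc
      Suc_eq_plus1)
  show ?case
  proof (cases "even m")
    case True
    then have "m = 2 * a" "m' = Suc (2 * a')"
      using parity by (auto simp: a_def a'_def)
    then show ?thesis
      using IH parity' by (auto simp: runs_double runs_double_Suc runs_sign_double runs_sign_double_Suc)
  next
    case False
    then have "m = Suc (2 * a)" "m' = 2 * a'"
      using parity by (auto simp: a_def a'_def)
    then show ?thesis
      using IH parity' by (auto simp: runs_double runs_double_Suc runs_sign_double runs_sign_double_Suc)
  qed
qed

text \<open>The two arguments are binary complements. For \<open>k > 0\<close> complementing
  preserves whether the last two digits differ, so the sign changes as \<open>runs_sign\<close> does
  in \<open>runs_complement\<close>. The factor is that of \<open>set_det_reflect_1\<close>.\<close>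

lemma det_sign_complement:
  assumes "d < 2 ^ k"
  shows "det_sign (2 ^ k + d) = - ((-1) ^ d * det_sign (2 ^ k - d - 1))"
proof (cases k)
  case 0
  then show ?thesis
    using assms runs_sign_double_Suc[of 0] by (simp add: det_sign_def)
next
  case (Suc l)
  define m m' where "m = 2 ^ k + d" and "m' = 2 ^ k - d - 1"
  have total: "m + m' + 1 = 2 ^ (k + 1)"
    using assms by (simp add: m_def m'_def)
  then obtain q where sum: "m + m' + 1 = 4 * q"
    using Suc by simp
  have half: "m div 2 + m' div 2 + 1 = 2 * q"
    using sum by presburger
  have "even m' \<longleftrightarrow> odd m"
    using sum by presburger
  moreover have "even (m' div 2) \<longleftrightarrow> odd (m div 2)"
    using half by presburger
  moreover have "even m \<longleftrightarrow> even d"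
    using Suc by (simp add: m_def)
  moreover have "runs_sign m = (if even m' then runs_sign m' else - runs_sign m')"
    using runs_complement[OF total] by (simp add: m_def)
  ultimately show ?thesis
    unfolding m_def[symmetric] m'_def[symmetric] by (auto simp: det_sign_def)
qed

text \<open>Reflection at the leading power of 2 sends \<open>m\<close> to its complement
  \<open>m'\<close>. Adding the determinant without the root turns the factor
  \<open>1 + runs m'\<close> into \<open>2 + runs m'\<close>, which is
  \<open>1 + runs m\<close>.\<close>

lemma set_det_closed_form:
  "set_det {0..<Suc m} pow_hankel = det_sign m * (1 + runs m) \<and>
   set_det {1..<Suc m} pow_hankel = det_sign m"
proof (induction m rule: less_induct)
  case (less m)
  show ?case
  proof (cases "m = 0")
    case True
    have "set_det (insert 0 {}) pow_hankel = 1"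
      by (subst set_det_isolated) (auto simp: pow_hankel_def)
    then show ?thesis
      using True by (simp add: det_sign_def)
  next
    case False
    then obtain k where k: "2 ^ k \<le> m" "m < 2 ^ (k + 1)"
      using ex_power_ivl1[of 2 m] by auto
    define d where "d = m - 2 ^ k"
    define m' where "m' = 2 ^ k - d - 1"
    have d: "d < 2 ^ k" "m = 2 ^ k + d" and m': "2 ^ k - d = Suc m'" "m' < m"
      using k by (auto simp: d_def m'_def)
    have "m + m' + 1 = 2 ^ (k + 1)"
      using d m' by simp
    then have "runs m = runs m' + 1"
      using runs_complement k(1) by blast
    moreover have "det_sign m = - ((-1) ^ d * det_sign m')"
      using det_sign_complement[OF d(1)] by (simp add: d(2) m'_def)
    moreover note less.IH[OF m'(2)]
    moreover note set_det_reflect_0[OF d(1)] set_det_reflect_1[OF d(1)]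
    ultimately show ?thesis
      using d(2) m'(1) by (simp add: algebra_simps)
  qed
qed

section \<open>Regularity\<close>

text \<open>Closure of the generators under both halvings extends linearly to their span, which
  therefore contains the whole kernel.\<close>

lemma two_regularI:
  assumes "finite B" "B \<subseteq> two_kernel x" "x \<in> int_seq.span B"
    and even: "\<And>y. y \<in> B \<Longrightarrow> (\<lambda>n. y (2 * n)) \<in> int_seq.span B"
    and odd: "\<And>y. y \<in> B \<Longrightarrow> (\<lambda>n. y (2 * n + 1)) \<in> int_seq.span B"
  shows "two_regular x"
proof -
  have closed: "(\<lambda>n. y (2 * n + b)) \<in> int_seq.span B" if "y \<in> int_seq.span B" "b < 2" for y b
    using that(1)
  proof (induction rule: int_seq.span_induct_alt)
    case base
    then show ?case using int_seq.span_zero[of B] by (simp add: zero_fun_def)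
  next
    case (step c z y)
    have "(\<lambda>n. z (2 * n + b)) \<in> int_seq.span B"
      using step(1) even odd that(2) by (auto simp: less_2_cases_iff)
    from int_seq.span_add[OF int_seq.span_scale[OF this, of c] step(2)]
    show ?case by (simp add: plus_fun_def)
  qed
  have "(\<lambda>n. x (2 ^ i * n + j)) \<in> int_seq.span B" if "j < 2 ^ i" for i j
    using that
  proof (induction i arbitrary: j)
    case 0
    then show ?case using assms(3) by simp
  next
    case (Suc i)
    \<comment> \<open>The top digit \<open>j div 2 ^ i\<close> is split off, so the last halving
      acts on a level \<open>i\<close> sequence.\<close>
    have "j mod 2 ^ i < 2 ^ i" "j div 2 ^ i < 2"
      using Suc.prems by (simp_all add: less_mult_imp_div_less)
    from closed[OF Suc.IH[OF this(1)] this(2)]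
    have "(\<lambda>n. x (2 ^ i * (2 * n + j div 2 ^ i) + j mod 2 ^ i)) \<in> int_seq.span B" .
    moreover have "2 ^ i * (2 * n + j div 2 ^ i) + j mod 2 ^ i = 2 ^ Suc i * n + j" for n
      by (simp add: algebra_simps)
    ultimately show ?case by (simp only:)
  qed
  then have "two_kernel x \<subseteq> int_seq.span B"
    by (auto simp: two_kernel_def less_eq_Suc_le le_diff_conv2 simp flip: Suc_le_eq)
  then have "int_seq.span (two_kernel x) \<subseteq> int_seq.span B"
    by (simp add: int_seq.span_minimal)
  with int_seq.span_mono[OF assms(2)] have "int_seq.span B = int_seq.span (two_kernel x)"
    by auto
  with assms(1) show ?thesis unfolding two_regular_def by blast
qed

theorem theorem26:
  fixes h :: "nat \<Rightarrow> int"
  assumes "\<And>n. h n = hankel_det n (1 - fps_X * r_series)"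
  shows "two_regular h"
proof -
  have h_Suc: "h (Suc m) = det_sign m * (1 + runs m)" for m
    by (simp only: assms hankel_det_eq_set_det set_det_closed_form)
  have h_odd: "h (2 * m + 1) = runs_sign m * (1 + runs m + (if even m then 0 else 1))" for m
    using h_Suc[of "2 * m"] by (simp add: det_sign_double runs_double)
  have h_even: "h (2 * m + 2) = (if even m then - runs_sign m * (2 + runs m)
      else runs_sign m * (1 + runs m))" for m
    using h_Suc[of "Suc (2 * m)"] by (simp add: det_sign_double_Suc runs_double_Suc)
  have runs4: "runs (4 * n) = runs (2 * n)" "runs (4 * n + 1) = runs (2 * n) + 1"
    "runs (4 * n + 2) = runs (2 * n + 1) + 1" "runs (4 * n + 3) = runs (2 * n + 1)" for n
    using runs_double[of "2 * n"] runs_double_Suc[of "2 * n"]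
      runs_double[of "2 * n + 1"] runs_double_Suc[of "2 * n + 1"]
    by (simp_all add: numeral_3_eq_3)
  have sign4: "runs_sign (4 * n) = runs_sign (2 * n)" "runs_sign (4 * n + 1) = runs_sign (2 * n)"
    "runs_sign (4 * n + 2) = - runs_sign (2 * n + 1)" "runs_sign (4 * n + 3) = runs_sign (2 * n + 1)"
    for n
    using runs_sign_double[of "2 * n"] runs_sign_double_Suc[of "2 * n"]
      runs_sign_double[of "2 * n + 1"] runs_sign_double_Suc[of "2 * n + 1"]
    by (simp_all add: numeral_3_eq_3)
  have arg: "2 * (4 * n + 1) + 1 = 8 * n + 3" "2 * (4 * n + 1) + 2 = 8 * n + 4"
    "2 * (4 * n + 2) + 1 = 8 * n + 5" "2 * (4 * n + 2) + 2 = 8 * n + 6"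
    "2 * (4 * n + 3) + 1 = 8 * n + 7" "2 * (4 * n + 3) + 2 = 8 * n + 8"
    "2 * (2 * n + 1) + 2 = 4 * n + 4" for n :: nat
    by simp_all
  have h4: "h (4 * n + 1) = runs_sign (2 * n) * (1 + runs (2 * n))"
    "h (4 * n + 2) = - runs_sign (2 * n) * (2 + runs (2 * n))"
    "h (4 * n + 3) = runs_sign (2 * n + 1) * (2 + runs (2 * n + 1))" for n
    using h_odd[of "2 * n"] h_even[of "2 * n"] h_odd[of "2 * n + 1"]
    by (simp_all add: numeral_3_eq_3)
  have h8: "h (8 * n + 1) = runs_sign (2 * n) * (1 + runs (2 * n))"
    "h (8 * n + 2) = - runs_sign (2 * n) * (2 + runs (2 * n))"
    "h (8 * n + 3) = runs_sign (2 * n) * (3 + runs (2 * n))"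
    "h (8 * n + 4) = runs_sign (2 * n) * (2 + runs (2 * n))"
    "h (8 * n + 5) = - runs_sign (2 * n + 1) * (2 + runs (2 * n + 1))"
    "h (8 * n + 6) = runs_sign (2 * n + 1) * (3 + runs (2 * n + 1))"
    "h (8 * n + 7) = runs_sign (2 * n + 1) * (2 + runs (2 * n + 1))" for n
    using h_odd[of "4 * n"] h_even[of "4 * n"] h_odd[of "4 * n + 1"] h_even[of "4 * n + 1"]
      h_odd[of "4 * n + 2"] h_even[of "4 * n + 2"] h_odd[of "4 * n + 3"]
    unfolding runs4 sign4 arg by simp_all
  \<comment> \<open>The values \<open>h4\<close> contain only one combination of the data at
    \<open>2 * n + 1\<close>. This supplies the second one, needed for \<open>h (8 * n + 6)\<close>;
    the term \<open>- runs_sign (2 * n)\<close> equals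
    \<open>h (4 * n + 1) + h (4 * n + 2)\<close>.\<close>
  have h2: "h (2 * n + 1) =
      runs_sign (2 * n + 1) * (1 + runs (2 * n + 1)) - runs_sign (2 * n)" for n
    unfolding h_odd using runs_double_Suc[of n] runs_sign_double[of n] runs_sign_double_Suc[of n]
    by (simp add: algebra_simps)
  have h8_rel: "h (8 * n + 1) = h (4 * n + 1)"
    "h (8 * n + 2) = h (4 * n + 2)"
    "h (8 * n + 3) = - h (4 * n + 1) + (-2) * h (4 * n + 2)"
    "h (8 * n + 4) = - h (4 * n + 2)"
    "h (8 * n + 5) = - h (4 * n + 3)"
    "h (8 * n + 6) = - h (2 * n + 1) + h (4 * n + 1) + h (4 * n + 2) + 2 * h (4 * n + 3)"
    "h (8 * n + 7) = h (4 * n + 3)" for n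
    unfolding h8 h4 h2 by (simp_all add: algebra_simps)
  \<comment> \<open>For \<open>n = 0\<close> both sides are \<open>h 0\<close>, which the closed
    form does not cover; hence the shift to \<open>p\<close>.\<close>
  have h8_0: "h (8 * n) = h (4 * n)" for n
  proof (cases n)
    case (Suc p)
    have "h (8 * p + 8) = h (4 * p + 4)"
      using h_even[of "4 * p + 3"] h_even[of "2 * p + 1"] unfolding runs4 sign4 arg
      by simp
    then show ?thesis
      by (simp add: Suc algebra_simps)
  qed simp
  \<comment> \<open>All seven kernel sequences of levels 0, 1 and 2. Halving those of level 2 gives
    level 3, which \<open>h8_rel\<close> and \<open>h8_0\<close> bring back to levels 1 and
    2.\<close>
  define B where "B = {h, \<lambda>n. h (2 * n), \<lambda>n. h (2 * n + 1), \<lambda>n. h (4 * n), \<lambda>n. h (4 * n + 1),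
    \<lambda>n. h (4 * n + 2), \<lambda>n. h (4 * n + 3)}"
  have "(\<lambda>n. h (2 ^ i * n + j)) \<in> two_kernel h" if "j \<le> 2 ^ i - 1" for i j
    using that unfolding two_kernel_def by blast
  from this[of 0 0] this[of 0 1] this[of 1 1] this[of 0 2] this[of 1 2] this[of 2 2] this[of 3 2]
  have kernel: "B \<subseteq> two_kernel h"
    by (simp add: B_def)
  have gen: "(\<lambda>n. h (2 * n)) \<in> int_seq.span B" "(\<lambda>n. h (2 * n + 1)) \<in> int_seq.span B"
    "(\<lambda>n. h (4 * n)) \<in> int_seq.span B" "(\<lambda>n. h (4 * n + 1)) \<in> int_seq.span B"
    "(\<lambda>n. h (4 * n + 2)) \<in> int_seq.span B" "(\<lambda>n. h (4 * n + 3)) \<in> int_seq.span B"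
    "h \<in> int_seq.span B"
    by (auto simp: B_def intro: int_seq.span_base)
  have add: "(\<lambda>n. f n + g n) \<in> int_seq.span B"
    if "f \<in> int_seq.span B" "g \<in> int_seq.span B" for f g
    using int_seq.span_add[OF that] by (simp add: plus_fun_def)
  have scale: "(\<lambda>n. c * f n) \<in> int_seq.span B" if "f \<in> int_seq.span B" for c f
    using int_seq.span_scale[OF that, of c] .
  have neg: "(\<lambda>n. - f n) \<in> int_seq.span B" if "f \<in> int_seq.span B" for f
    using scale[OF that, of "-1"] by simp
  have gen8: "(\<lambda>n. h (8 * n + j)) \<in> int_seq.span B" if "j < 8" for j
  proof -
    have "j \<in> {0, 1, 2, 3, 4, 5, 6, 7}" using that by auto
    then show ?thesis
      by (elim insertE emptyE; simp only: h8_rel h8_0 add_0_right; intro gen add neg scale)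
  qed
  have sub: "2 * (2 * n) = 4 * n" "2 * (2 * n + 1) = 4 * n + 2"
    "4 * n + 2 + 1 = 4 * n + 3" "4 * (2 * n) = 8 * n" "4 * (2 * n + 1) = 8 * n + 4"
    "8 * n + 4 + 1 = 8 * n + 5" "8 * n + 4 + 2 = 8 * n + 6" "8 * n + 4 + 3 = 8 * n + 7" for n :: nat
    by simp_all
  have step: "(\<lambda>n. y (2 * n)) \<in> int_seq.span B" "(\<lambda>n. y (2 * n + 1)) \<in> int_seq.span B"
    if "y \<in> B" for y
  proof -
    note g = gen gen8[of 0, unfolded add_0_right] gen8[of 1] gen8[of 2] gen8[of 3] gen8[of 4]
      gen8[of 5] gen8[of 6] gen8[of 7]
    have y: "y \<in> {h, \<lambda>n. h (2 * n), \<lambda>n. h (2 * n + 1), \<lambda>n. h (4 * n), \<lambda>n. h (4 * n + 1),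
      \<lambda>n. h (4 * n + 2), \<lambda>n. h (4 * n + 3)}"
      using that by (simp only: B_def)
    show "(\<lambda>n. y (2 * n)) \<in> int_seq.span B"
      using y by (elim insertE emptyE; simp only: sub; intro g; simp)
    show "(\<lambda>n. y (2 * n + 1)) \<in> int_seq.span B"
      using y by (elim insertE emptyE; simp only: sub; intro g; simp)
  qed
  have "finite B"
    by (simp add: B_def)
  then show ?thesis
    using kernel gen(7) step by (rule two_regularI)
qed

end
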